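(* Let $S$ be a compact right topological left adequate partial semigroup. Then $S$ has an idempotent, i.e. $E(S)\neq\emptyset$.
   Context: A partial semigroup is a nonempty set $S$ with a partially defined operation $\bullet$ such that $(x\bullet y)\bullet z=x\bullet(y\bullet z)$ in the sense that if either side is defined so is the other and they are equal. $L(x)=\{s:s\bullet x\text{ defined}\}$; $S$ is left adequate if $\bigcap_{s\in H}L(s)\neq\emptyset$ for every finite nonempty $H\subseteq S$. A right topological left adequate partial semigroup is a left adequate partial semigroup $(S,\bullet)$ with a topology such that for every $s\in S$ the map $r_s:\overline{L(s)}\to S$, $r_s(x)=x\bullet s$, is continuous. It is compact if the topology is compact. $E(S)=\{e\in S: e\bullet e=e\}$.
   Formalization: The topology on S is additionally assumed Hausdorff; without this the claim fails, e.g. for the positive integers under addition with the indiscrete (or cofinite) topology, which are compact and right topological but have no idempotent. *)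

theory Defs
  imports "HOL-Analysis.Analysis"
begin

text \<open>A partial operation on a carrier is a function into \<^typ>\<open>'a option\<close>, with
  \<open>None\<close> for undefined. Equality of the two \<open>Option.bind\<close> terms below says that if
  either bracketing of the product is defined then so is the other, with the same value.\<close>

locale partial_semigroup =
  fixes S :: "'a set" and opr :: "'a \<Rightarrow> 'a \<Rightarrow> 'a option"
  assumes nonempty: "S \<noteq> {}"
    and closed: "\<lbrakk>x \<in> S; y \<in> S; opr x y = Some z\<rbrakk> \<Longrightarrow> z \<in> S"
    and assoc: "\<lbrakk>x \<in> S; y \<in> S; z \<in> S\<rbrakk> \<Longrightarrow>
      Option.bind (opr x y) (\<lambda>u. opr u z) = Option.bind (opr y z) (\<lambda>v. opr x v)"

definition left_dom :: "'a set \<Rightarrow> ('a \<Rightarrow> 'a \<Rightarrow> 'a option) \<Rightarrow> 'a \<Rightarrow> 'a set" where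
  "left_dom S opr x = {s \<in> S. opr s x \<noteq> None}"

definition idempotents :: "'a set \<Rightarrow> ('a \<Rightarrow> 'a \<Rightarrow> 'a option) \<Rightarrow> 'a set" where
  "idempotents S opr = {e \<in> S. opr e e = Some e}"

locale left_adequate_partial_semigroup = partial_semigroup S opr
  for S :: "'a set" and opr :: "'a \<Rightarrow> 'a \<Rightarrow> 'a option" +
  assumes left_adequate: "\<lbrakk>finite H; H \<noteq> {}; H \<subseteq> S\<rbrakk> \<Longrightarrow> (\<Inter>s\<in>H. left_dom S opr s) \<noteq> {}"

text \<open>The map \<open>x \<mapsto> x \<bullet> s\<close> has the closure of \<open>L(s)\<close> as its domain, so the
  product has to be defined there; this is the assumption \<open>right_mult_defined\<close>, without which
  \<open>the (opr x s)\<close> would be an unspecified value at some points of the closure.\<close>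

locale right_topological_left_adequate_partial_semigroup =
  left_adequate_partial_semigroup "topspace X" opr
  for X :: "'a topology" and opr :: "'a \<Rightarrow> 'a \<Rightarrow> 'a option" +
  assumes right_mult_defined:
      "\<lbrakk>s \<in> topspace X; x \<in> X closure_of left_dom (topspace X) opr s\<rbrakk> \<Longrightarrow> opr x s \<noteq> None"
    and right_mult_continuous: "s \<in> topspace X \<Longrightarrow>
      continuous_map (subtopology X (X closure_of left_dom (topspace X) opr s)) X
        (\<lambda>x. the (opr x s))"

end

theory Submission
  imports Defs
begin

text \<open>Since \<open>x \<bullet> s\<close> is defined for every \<open>x\<close> in the closure of \<open>L(s)\<close>, each \<open>L(s)\<close> is closed. Left
  adequacy and compactness make the intersection \<open>D\<close> of all \<open>L(s)\<close> nonempty. If \<open>x, y \<in> D\<close>, then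
  \<open>x \<bullet> (y \<bullet> s)\<close>, and hence \<open>(x \<bullet> y) \<bullet> s\<close>, is defined for every \<open>s\<close>, so \<open>D\<close> is a compact right
  topological semigroup whose operation is total, and the Ellis--Numakura lemma applies to it: in a
  minimal closed subsemigroup \<open>A\<close>, minimality gives \<open>A \<bullet> e = A\<close> and then \<open>{x \<in> A. x \<bullet> e = e} = A\<close> for any
  \<open>e \<in> A\<close>, so \<open>e\<close> is idempotent.\<close>

lemma finite_chain_Inter_mem:
  assumes "finite F" "F \<noteq> {}" and "\<And>A B. A \<in> F \<Longrightarrow> B \<in> F \<Longrightarrow> A \<subseteq> B \<or> B \<subseteq> A"
  shows "\<Inter>F \<in> F"
  using assms
proof (induction F rule: finite_ne_induct)
  case (insert A F)
  then have "\<Inter>F \<in> F" by blast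
  with insert.prems have "A \<subseteq> \<Inter>F \<or> \<Inter>F \<subseteq> A" by blast
  then have "\<Inter>(insert A F) = A \<or> \<Inter>(insert A F) = \<Inter>F"
    by (auto simp only: Inf_insert inf.absorb1 inf.absorb2)
  with \<open>\<Inter>F \<in> F\<close> show ?case by auto
qed simp

lemma compact_space_fip_nonempty:
  assumes "compact_space X" and "\<And>A. A \<in> \<U> \<Longrightarrow> closedin X A"
    and "\<And>F. finite F \<Longrightarrow> F \<subseteq> \<U> \<Longrightarrow> \<Inter>F \<noteq> {}"
  shows "\<Inter>\<U> \<noteq> {}"
  using assms(1)[unfolded compact_space_fip, THEN spec[of _ \<U>]] assms(2,3) by simp

text \<open>A finite nonempty subfamily of a chain contains its own intersection, so the finite
  intersection property holds. Adding \<open>topspace X\<close> as largest member keeps the family a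
  chain and lets the empty chain yield \<open>topspace X\<close> rather than the whole type.\<close>

lemma compact_space_chain_Inter_nonempty:
  assumes "compact_space X" and "topspace X \<noteq> {}"
    and "\<And>A. A \<in> C \<Longrightarrow> closedin X A \<and> A \<noteq> {}"
    and "\<And>A B. A \<in> C \<Longrightarrow> B \<in> C \<Longrightarrow> A \<subseteq> B \<or> B \<subseteq> A"
  shows "topspace X \<inter> \<Inter>C \<noteq> {}"
proof -
  have "\<Inter>(insert (topspace X) C) \<noteq> {}"
  proof (rule compact_space_fip_nonempty[OF assms(1)])
    show "closedin X A" if "A \<in> insert (topspace X) C" for A
      using that assms(3) by auto
    show "\<Inter>F \<noteq> {}" if F: "finite F" "F \<subseteq> insert (topspace X) C" for F
    proof (cases "F = {}")
      case False
      have "A \<subseteq> B \<or> B \<subseteq> A" if "A \<in> F" "B \<in> F" for A B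
      proof -
        have "A \<subseteq> topspace X" "B \<subseteq> topspace X"
          using that F(2) assms(3) closedin_subset by fast+
        with that F(2) assms(4)[of A B] show ?thesis by blast
      qed
      with F(1) False have "\<Inter>F \<in> F" by (rule finite_chain_Inter_mem)
      with F(2) assms(2) assms(3)[of "\<Inter>F"] show ?thesis by auto
    qed simp
  qed
  then show ?thesis by simp
qed

lemma Ellis_Numakura:
  fixes X :: "'a topology" and m :: "'a \<Rightarrow> 'a \<Rightarrow> 'a"
  assumes comp: "compact_space X" and haus: "Hausdorff_space X" and ne: "topspace X \<noteq> {}"
    and closed: "\<And>x y. x \<in> topspace X \<Longrightarrow> y \<in> topspace X \<Longrightarrow> m x y \<in> topspace X"
    and assoc: "\<And>x y z. x \<in> topspace X \<Longrightarrow> y \<in> topspace X \<Longrightarrow> z \<in> topspace X \<Longrightarrow>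
      m (m x y) z = m x (m y z)"
    and cont: "\<And>s. s \<in> topspace X \<Longrightarrow> continuous_map X X (\<lambda>x. m x s)"
  shows "\<exists>e\<in>topspace X. m e e = e"
proof -
  define \<A> where "\<A> = {A. closedin X A \<and> A \<noteq> {} \<and> (\<forall>x\<in>A. \<forall>y\<in>A. m x y \<in> A)}"
  \<comment> \<open>Zorn's lemma is applied to reverse inclusion, so a maximal element is a minimal
    closed subsemigroup; a chain is bounded by its intersection.\<close>
  have "\<exists>A\<in>\<A>. \<forall>B\<in>\<A>. A \<supseteq> B \<longrightarrow> B = A"
  proof (rule predicate_Zorn)
    show "partial_order_on \<A> (relation_of (\<supseteq>) \<A>)"
      by (rule partial_order_on_relation_ofI) auto
  next
    fix C assume C: "C \<in> Chains (relation_of (\<supseteq>) \<A>)"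
    have sub: "A \<in> \<A>" if "A \<in> C" for A
      using C that unfolding Chains_def relation_of_def by blast
    have "A \<subseteq> B \<or> B \<subseteq> A" if "A \<in> C" "B \<in> C" for A B
      using C that unfolding Chains_def relation_of_def by blast
    with comp ne sub have "topspace X \<inter> \<Inter>C \<noteq> {}"
      by (intro compact_space_chain_Inter_nonempty) (auto simp: \<A>_def)
    moreover have "closedin X (\<Inter>(insert (topspace X) C))"
      using sub by (intro closedin_Inter) (auto simp: \<A>_def)
    moreover have "\<forall>x\<in>topspace X \<inter> \<Inter>C. \<forall>y\<in>topspace X \<inter> \<Inter>C. m x y \<in> topspace X \<inter> \<Inter>C"
      using sub closed unfolding \<A>_def by blast
    ultimately have "topspace X \<inter> \<Inter>C \<in> \<A>"
      by (simp add: \<A>_def)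
    then show "\<exists>u\<in>\<A>. \<forall>a\<in>C. a \<supseteq> u" by (rule bexI[rotated]) auto
  qed
  then obtain A where "A \<in> \<A>" and minimal: "\<And>B. B \<in> \<A> \<Longrightarrow> B \<subseteq> A \<Longrightarrow> B = A"
    by blast
  then have A: "closedin X A" "A \<noteq> {}" "\<And>x y. x \<in> A \<Longrightarrow> y \<in> A \<Longrightarrow> m x y \<in> A"
    by (auto simp: \<A>_def)
  have AX: "x \<in> topspace X" if "x \<in> A" for x
    using A(1) that closedin_subset by blast
  from A(2) obtain e where e: "e \<in> A" by blast
  \<comment> \<open>The image is compact, hence closed because \<open>X\<close> is Hausdorff, and
    products stay in it since \<open>(x e) (y e) = ((x e) y) e\<close>.\<close>
  have "(\<lambda>x. m x e) ` A = A"
  proof (rule minimal)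
    have "compactin X ((\<lambda>x. m x e) ` A)"
      by (rule image_compactin[OF closedin_compact_space[OF comp A(1)] cont[OF AX[OF e]]])
    then have "closedin X ((\<lambda>x. m x e) ` A)"
      using haus compactin_imp_closedin by blast
    moreover have "m (m x e) (m y e) \<in> (\<lambda>x. m x e) ` A" if "x \<in> A" "y \<in> A" for x y
    proof -
      have "m (m x e) (m y e) = m (m (m x e) y) e"
        using that e A(3) AX by (simp add: assoc)
      then show ?thesis using that e A(3) by blast
    qed
    ultimately show "(\<lambda>x. m x e) ` A \<in> \<A>"
      using A(2) by (auto simp: \<A>_def)
  qed (use A(3) e in blast)
  \<comment> \<open>As \<open>e\<close> itself lies in the image, some \<open>f\<close> satisfies
    \<open>f e = e\<close>; this makes the next set nonempty.\<close>
  then obtain f where f: "f \<in> A" "m f e = e"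
    using e by (metis (no_types, lifting) imageE)
  \<comment> \<open>This set is the trace on \<open>A\<close> of the preimage of the closed point
    \<open>e\<close>, and \<open>(x y) e = x (y e) = x e = e\<close> keeps it closed under
    \<open>m\<close>.\<close>
  have "{x \<in> A. m x e = e} = A"
  proof (rule minimal)
    have "closedin X {e}"
      using haus AX[OF e] by (simp add: closedin_Hausdorff_singleton)
    then have "closedin X {x \<in> topspace X. m x e \<in> {e}}"
      using cont[OF AX[OF e]] by (intro closedin_continuous_map_preimage)
    then have "closedin X (A \<inter> {x \<in> topspace X. m x e \<in> {e}})"
      using A(1) by blast
    moreover have "A \<inter> {x \<in> topspace X. m x e \<in> {e}} = {x \<in> A. m x e = e}"
      using AX by blast
    ultimately have "closedin X {x \<in> A. m x e = e}" by simp
    then show "{x \<in> A. m x e = e} \<in> \<A>"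
      using f e A(3) AX assoc by (auto simp: \<A>_def)
  qed blast
  with e AX show ?thesis by blast
qed

context right_topological_left_adequate_partial_semigroup
begin

lemma closedin_left_dom:
  assumes "s \<in> topspace X"
  shows "closedin X (left_dom (topspace X) opr s)"
proof -
  have "X closure_of left_dom (topspace X) opr s \<subseteq> left_dom (topspace X) opr s"
    using right_mult_defined[OF assms] closure_of_subset_topspace
    by (fastforce simp: left_dom_def)
  then show ?thesis
    by (metis (no_types, lifting) closure_of_subset_eq left_dom_def mem_Collect_eq subsetI)
qed

text \<open>A finite family of sets \<open>L(s)\<close> is indexed by a finite set \<open>H\<close>
  of points, so left adequacy supplies the finite intersection property.\<close>

lemma Inter_left_dom_nonempty:
  assumes "compact_space X"
  shows "(\<Inter>s\<in>topspace X. left_dom (topspace X) opr s) \<noteq> {}"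
proof (rule compact_space_fip_nonempty[OF assms])
  show "closedin X A" if "A \<in> left_dom (topspace X) opr ` topspace X" for A
    using that closedin_left_dom by auto
  show "\<Inter>F \<noteq> {}" if F: "finite F" "F \<subseteq> left_dom (topspace X) opr ` topspace X" for F
  proof (cases "F = {}")
    case False
    from F obtain H where "H \<subseteq> topspace X" "finite H" "F = left_dom (topspace X) opr ` H"
      by (meson finite_subset_image)
    with False left_adequate[of H] show ?thesis by auto
  qed simp
qed

lemma idempotents_nonempty:
  assumes "compact_space X" and "Hausdorff_space X"
  shows "idempotents (topspace X) opr \<noteq> {}"
proof -
  define D where "D = (\<Inter>s\<in>topspace X. left_dom (topspace X) opr s)"
  have D_ne: "D \<noteq> {}"
    unfolding D_def using assms(1) by (rule Inter_left_dom_nonempty)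
  \<comment> \<open>The carrier is nonempty, so this is an intersection over a nonempty family and
    not the whole type.\<close>
  have D_closed: "closedin X D"
    unfolding D_def using nonempty closedin_left_dom by (intro closedin_Inter) auto
  then have D_sub: "D \<subseteq> topspace X" by (rule closedin_subset)
  have D_opr: "\<exists>z\<in>topspace X. opr x s = Some z" if "x \<in> D" "s \<in> topspace X" for x s
    using that D_sub closed unfolding D_def left_dom_def by blast
  have D_mult: "the (opr x y) \<in> D" if xy: "x \<in> D" "y \<in> D" for x y
  proof -
    obtain z where z: "opr x y = Some z" "z \<in> topspace X"
      using D_opr xy D_sub by blast
    have "opr z s \<noteq> None" if s: "s \<in> topspace X" for s
    proof -
      obtain v where v: "opr y s = Some v" "v \<in> topspace X"
        using D_opr xy(2) s by blast
      have "opr z s = opr x v"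
        using assoc[of x y s] z v D_sub s xy by auto
      then show ?thesis using D_opr[OF xy(1) v(2)] by auto
    qed
    with z show ?thesis by (simp add: D_def left_dom_def)
  qed
  have D_assoc: "the (opr (the (opr x y)) z) = the (opr x (the (opr y z)))"
    if xyz: "x \<in> D" "y \<in> D" "z \<in> D" for x y z
  proof -
    obtain u v where "opr x y = Some u" "opr y z = Some v"
      using D_opr xyz D_sub by blast
    then show ?thesis using assoc[of x y z] xyz[THEN subsetD[OF D_sub]] by simp
  qed
  have top_D: "topspace (subtopology X D) = D"
    using D_sub by (rule topspace_subtopology_subset)
  \<comment> \<open>Products of members of \<open>D\<close> are always defined, so
    \<open>the\<close> never meets \<open>None\<close> here and gives a genuine total
    operation.\<close>
  have "\<exists>e\<in>topspace (subtopology X D). the (opr e e) = e"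
  proof (rule Ellis_Numakura[where m = "\<lambda>x y. the (opr x y)"])
    show "compact_space (subtopology X D)"
      using D_closed assms(1) closedin_compact_space compact_space_subtopology by blast
    show "Hausdorff_space (subtopology X D)"
      using assms(2) by (rule Hausdorff_space_subtopology)
    fix s assume "s \<in> topspace (subtopology X D)"
    then have s: "s \<in> D" "s \<in> topspace X" using top_D D_sub by auto
    \<comment> \<open>This places \<open>D\<close> in the domain on which right multiplication by
      \<open>s\<close> is continuous, so continuity restricts to \<open>D\<close>;
      \<open>D_mult\<close> then narrows the codomain.\<close>
    have "D \<subseteq> X closure_of left_dom (topspace X) opr s"
      using s closure_of_closedin[OF closedin_left_dom[OF s(2)]] unfolding D_def by blast
    with right_mult_continuous[OF s(2)]
    have "continuous_map (subtopology X D) X (\<lambda>x. the (opr x s))"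
      by (rule continuous_map_from_subtopology_mono)
    then show "continuous_map (subtopology X D) (subtopology X D) (\<lambda>x. the (opr x s))"
      using D_mult s top_D by (auto simp: continuous_map_in_subtopology)
  qed (use top_D D_ne D_mult D_assoc in auto)
  then obtain e where e: "e \<in> D" "the (opr e e) = e"
    using top_D by auto
  moreover have "opr e e \<noteq> None" using D_opr e D_sub by blast
  ultimately have "e \<in> idempotents (topspace X) opr"
    using D_sub by (auto simp: idempotents_def)
  then show ?thesis by blast
qed

end

theorem theorem2p24:
  fixes X :: "'a topology" and opr :: "'a \<Rightarrow> 'a \<Rightarrow> 'a option"
  assumes "right_topological_left_adequate_partial_semigroup X opr"
    and "compact_space X"
    and "Hausdorff_space X"
  shows "idempotents (topspace X) opr \<noteq> {}"
  using right_topological_left_adequate_partial_semigroup.idempotents_nonempty[OF assms] .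

end
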